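(* Let $k\ge 0$ and suppose that - $f$ is a Lipschitz continuous vector function, - $g_1,\dots,g_m$ are continuous vector functions, and - $w_i(t)=0$ for all $t\in[t_k,t_{k+1}]$ and all $i=1,\dots,m$ (so the auxiliary system is $\dot y=f(y)$). Let $x$ and $y$ be solutions on $[t_k,t_{k+1}]$ of the input-affine system and of the auxiliary system respectively, with $x(t_k)=y(t_k)$. Then the local error $\|x(t_{k+1})-y(t_{k+1})\|$ is $O(h)$. Moreover $$\|x(t_{k+1})-y(t_{k+1})\|\le h_k\,K'\,\varphi(\Lambda h_k),$$ and alternatively $$\|x(t_{k+1})-y(t_{k+1})\|\le h_k\,(2K+K').$$
   Context: Setting. The input-affine system is $$\dot x(t)=f(x(t))+\sum_{i=1}^m g_i(x(t))\,v_i(t),$$ where $f,g_1,\dots,g_m:\mathbb{R}^n\to\mathbb{R}^n$ and each $v_i$ is an arbitrary measurable function with $v_i(t)\in[-V_i,V_i]$, $V_i>0$. Solutions are absolutely continuous functions satisfying the equation for almost every $t$. The interval $[0,T]$ is partitioned as $0=t_0<t_1<\dots<t_N=T$ and $h_k=t_{k+1}-t_k$. On $[t_k,t_{k+1}]$ the auxiliary system is $$\dot y(t)=f(y(t))+\sum_{i=1}^m g_i(y(t))\,w_i(t),\qquad y(t_k)=x(t_k).$$ Norms. $\|\cdot\|$ is the supremum norm on $\mathbb{R}^n$. The logarithmic norm of a square matrix $Q$ is $\lambda(Q)=\lim_{h\to0^+}(\|I+hQ\|-1)/h$ with the induced matrix norm, i.e. $\lambda(Q)=\max_k\{q_{kk}+\sum_{i\ne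 k}|q_{ki}|\}$. Bounds. $B\subset\mathbb{R}^n$ is a box containing the values on $[0,T]$ of all solutions under consideration of both systems (for all admissible inputs). $f$ is continuously differentiable with Jacobian matrix $Df$. The constants satisfy, for all $z\in B$ and all $i$: $\|f(z)\|\le K$, $\|g_i(z)\|\le K_i$, $\lambda(Df(z))\le\Lambda$. Put $K'=\sum_{i=1}^m V_iK_i$ and $\varphi(s)=(e^s-1)/s$, with $\varphi(0)=1$. "Local error is $O(h)$" means bounded by $C h_k$ with $C$ depending only on $T$ and the constants above, not on $k$ or on the inputs. *)

theory Defs
  imports "HOL-Analysis.Analysis"
begin

(* The supremum norm on real ^ 'n is the library's infnorm.  The library's onorm is
   induced by the Euclidean norm, so the matrix norm induced by infnorm is introduced
   here in the same style as onorm (x = 0 contributes the harmless value 0 / 0 = 0). *)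
definition mat_infnorm :: "real ^ 'n ^ 'n \<Rightarrow> real" where
  "mat_infnorm Q = (SUP x. infnorm (Q *v x) / infnorm x)"

definition log_norm :: "real ^ 'n ^ 'n \<Rightarrow> real" where
  "log_norm Q = Lim (at_right 0) (\<lambda>h::real. (mat_infnorm (mat 1 + h *\<^sub>R Q) - 1) / h)"

definition phi :: "real \<Rightarrow> real" where
  "phi s = (if s = 0 then 1 else (exp s - 1) / s)"

(* Absolute continuity of a function on {a..b} in the epsilon-delta sense (the library's
   absolutely_continuous is about measures).  d ranges over all finite families of
   non-overlapping closed subintervals of {a..b}; for such k = {u..v}, Sup k = v and
   Inf k = u. *)
definition abs_continuous_on :: "real \<Rightarrow> real \<Rightarrow> (real \<Rightarrow> 'a::real_normed_vector) \<Rightarrow> bool" where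
  "abs_continuous_on a b x \<longleftrightarrow>
     (\<forall>\<epsilon>>0. \<exists>\<delta>>0. \<forall>d S. d division_of S \<and> S \<subseteq> {a..b} \<and> (\<Sum>k\<in>d. Sup k - Inf k) < \<delta> \<longrightarrow>
        (\<Sum>k\<in>d. norm (x (Sup k) - x (Inf k))) < \<epsilon>)"

definition admissible_input ::
    "nat \<Rightarrow> (nat \<Rightarrow> real) \<Rightarrow> real \<Rightarrow> real \<Rightarrow> (nat \<Rightarrow> real \<Rightarrow> real) \<Rightarrow> bool" where
  "admissible_input m V a b v \<longleftrightarrow>
     (\<forall>i\<in>{1..m}. v i \<in> borel_measurable (lebesgue_on {a..b}) \<and>
                  (\<forall>t\<in>{a..b}. v i t \<in> {- V i..V i}))"

definition affine_solution ::
    "(real ^ 'n \<Rightarrow> real ^ 'n) \<Rightarrow> nat \<Rightarrow> (nat \<Rightarrow> real ^ 'n \<Rightarrow> real ^ 'n) \<Rightarrow> (nat \<Rightarrow> real \<Rightarrow> real) \<Rightarrow>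
     real \<Rightarrow> real \<Rightarrow> (real \<Rightarrow> real ^ 'n) \<Rightarrow> bool" where
  "affine_solution f m g u a b x \<longleftrightarrow>
     abs_continuous_on a b x \<and>
     (AE t in lebesgue_on {a..b}.
        (x has_vector_derivative f (x t) + (\<Sum>i=1..m. u i t *\<^sub>R g i (x t))) (at t within {a..b}))"

end

theory Submission
  imports Defs
begin

text \<open>
  Write \<open>d = x - y\<close> for the difference of the two solutions; it starts at \<open>0\<close>, and almost everywhere
  \<open>d' = (f x - f y) + I\<close>, where the input term \<open>I\<close> has supremum norm at most \<open>K'\<close>. Both explicit
  bounds come from estimating how fast \<open>infnorm d\<close> can grow.

  The one-sided Lipschitz estimate behind the logarithmic norm is obtained row by row. The scalar mean
  value theorem applied to the \<open>k\<close>-th component of \<open>f\<close> expresses \<open>f x $ k - f y $ k\<close> by the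
  \<open>k\<close>-th row of a Jacobian at a point of the segment from \<open>y\<close> to \<open>x\<close>, which lies in the convex
  set \<open>B\<close>. That point depends on \<open>k\<close>, but for the supremum norm this is harmless, because the
  logarithmic norm is the largest of the row quantities \<open>Q $ k $ k + (\<Sum>i\<noteq>k. \<bar>Q $ k $ i\<bar>)\<close>
  (\<open>log_norm_eq_Max_row\<close>), so each row may be taken from a different matrix. Hence for small \<open>h > 0\<close>
  the Euler step \<open>d + h (f x - f y)\<close> has norm at most \<open>(1 + h \<Lambda>) infnorm d\<close>
  (\<open>infnorm_euler_step_le\<close>), and \<open>infnorm d\<close> has upper right derivative at most
  \<open>\<Lambda> infnorm d + K'\<close> almost everywhere. Estimating \<open>infnorm (f x - f y)\<close> by \<open>2 K\<close> instead
  gives the upper right derivative bound \<open>2 K + K'\<close>.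

  Both are turned into bounds at the right end point by the same comparison lemma
  (\<open>infnorm_gronwall\<close>), with growth rate \<open>\<Lambda>\<close> and \<open>0\<close> respectively. Since the derivatives exist only
  almost everywhere, it rests on the fact that an absolutely continuous function whose upper right
  derivative is at most \<open>0\<close> almost everywhere does not increase
  (\<open>abs_continuous_on_nonincreasing\<close>). The \<open>O(h)\<close> claim is the second bound, with constant
  \<open>2 K + K'\<close>.
\<close>

section \<open>Absolutely continuous functions\<close>

lemma division_of_real_elem:
  fixes k :: "real set"
  assumes "d division_of S" "k \<in> d" "S \<subseteq> {a..b}"
  obtains p q where "k = {p..q}" "p \<le> q" "a \<le> p" "q \<le> b" "Inf k = p" "Sup k = q"
proof -
  obtain p q where k: "k = {p..q}"
    using division_ofD(4)[OF assms(1,2)] by auto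
  moreover have "k \<noteq> {}" "k \<subseteq> {a..b}"
    using division_ofD(2,3)[OF assms(1,2)] assms(3) by auto
  ultimately show ?thesis
    using that[of p q] by auto
qed

lemma abs_continuous_onD:
  assumes "abs_continuous_on a b x" "\<epsilon> > 0"
  shows "\<exists>\<delta>>0. \<forall>d S. d division_of S \<and> S \<subseteq> {a..b} \<and> (\<Sum>k\<in>d. Sup k - Inf k) < \<delta> \<longrightarrow>
        (\<Sum>k\<in>d. norm (x (Sup k) - x (Inf k))) < \<epsilon>"
  using assms unfolding abs_continuous_on_def by simp

text \<open>
  The domination hypothesis covers in one stroke the norm of an absolutely continuous curve, its product
  with a smooth weight, and the addition of a smooth function.
\<close>

lemma abs_continuous_on_dominated:
  assumes x: "abs_continuous_on a b x"
    and dom: "\<And>p q. a \<le> p \<Longrightarrow> p \<le> q \<Longrightarrow> q \<le> b \<Longrightarrow>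
                norm (z q - z p) \<le> M * norm (x q - x p) + L * (q - p)"
  shows "abs_continuous_on a b z"
  unfolding abs_continuous_on_def
proof (intro allI impI)
  fix \<epsilon> :: real assume "\<epsilon> > 0"
  define M' where "M' = \<bar>M\<bar> + 1"
  define L' where "L' = \<bar>L\<bar> + 1"
  have pos: "M' > 0" "L' > 0" "M \<le> M'" "L \<le> L'"
    by (auto simp: M'_def L'_def)
  then have "\<epsilon> / (2 * M') > 0" using \<open>\<epsilon> > 0\<close> by simp
  from abs_continuous_onD[OF x this] obtain \<delta> where \<delta>: "\<delta> > 0"
    "\<forall>d S. d division_of S \<and> S \<subseteq> {a..b} \<and> (\<Sum>k\<in>d. Sup k - Inf k) < \<delta> \<longrightarrow>
        (\<Sum>k\<in>d. norm (x (Sup k) - x (Inf k))) < \<epsilon> / (2 * M')"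
    by (elim exE conjE) (rule that)
  show "\<exists>\<delta>>0. \<forall>d S. d division_of S \<and> S \<subseteq> {a..b} \<and> (\<Sum>k\<in>d. Sup k - Inf k) < \<delta> \<longrightarrow>
        (\<Sum>k\<in>d. norm (z (Sup k) - z (Inf k))) < \<epsilon>"
  proof (intro exI conjI allI impI)
    show "min \<delta> (\<epsilon> / (2 * L')) > 0"
      using \<delta>(1) pos \<open>\<epsilon> > 0\<close> by simp
    fix d S
    assume "d division_of S \<and> S \<subseteq> {a..b} \<and> (\<Sum>k\<in>d. Sup k - Inf k) < min \<delta> (\<epsilon> / (2 * L'))"
    then have d: "d division_of S" "S \<subseteq> {a..b}"
      and len: "(\<Sum>k\<in>d. Sup k - Inf k) < \<delta>" "(\<Sum>k\<in>d. Sup k - Inf k) < \<epsilon> / (2 * L')" by auto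
    have "(\<Sum>k\<in>d. norm (z (Sup k) - z (Inf k))) \<le>
          (\<Sum>k\<in>d. M' * norm (x (Sup k) - x (Inf k)) + L' * (Sup k - Inf k))"
    proof (rule sum_mono)
      fix k assume "k \<in> d"
      from d(1) this d(2) obtain p q where k: "p \<le> q" "a \<le> p" "q \<le> b" "Inf k = p" "Sup k = q"
        by (rule division_of_real_elem)
      have "norm (z q - z p) \<le> M * norm (x q - x p) + L * (q - p)"
        using dom k by blast
      also have "\<dots> \<le> M' * norm (x q - x p) + L' * (q - p)"
        using pos k by (intro add_mono mult_right_mono) auto
      finally show "norm (z (Sup k) - z (Inf k)) \<le> M' * norm (x (Sup k) - x (Inf k)) + L' * (Sup k - Inf k)"
        using k by simp
    qed
    also have "\<dots> = M' * (\<Sum>k\<in>d. norm (x (Sup k) - x (Inf k))) + L' * (\<Sum>k\<in>d. Sup k - Inf k)"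
      by (simp add: sum.distrib sum_distrib_left)
    also have "\<dots> < M' * (\<epsilon> / (2 * M')) + L' * (\<epsilon> / (2 * L'))"
      using pos by (intro add_strict_mono mult_strict_left_mono \<delta>(2)[rule_format, OF conjI[OF d(1) conjI[OF d(2) len(1)]]] len(2)) auto
    also have "\<dots> = \<epsilon>"
      using pos by (simp add: field_simps)
    finally show "(\<Sum>k\<in>d. norm (z (Sup k) - z (Inf k))) < \<epsilon>" .
  qed
qed

lemma abs_continuous_on_diff:
  assumes x: "abs_continuous_on a b x" and y: "abs_continuous_on a b y"
  shows "abs_continuous_on a b (\<lambda>t. x t - y t)"
  unfolding abs_continuous_on_def
proof (intro allI impI)
  fix \<epsilon> :: real assume "\<epsilon> > 0"
  then have e: "\<epsilon> / 2 > 0" by simp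
  from abs_continuous_onD[OF x e] obtain \<delta> where \<delta>: "\<delta> > 0"
    "\<forall>d S. d division_of S \<and> S \<subseteq> {a..b} \<and> (\<Sum>k\<in>d. Sup k - Inf k) < \<delta> \<longrightarrow>
        (\<Sum>k\<in>d. norm (x (Sup k) - x (Inf k))) < \<epsilon> / 2"
    by (elim exE conjE) (rule that)
  from abs_continuous_onD[OF y e] obtain \<delta>' where \<delta>': "\<delta>' > 0"
    "\<forall>d S. d division_of S \<and> S \<subseteq> {a..b} \<and> (\<Sum>k\<in>d. Sup k - Inf k) < \<delta>' \<longrightarrow>
        (\<Sum>k\<in>d. norm (y (Sup k) - y (Inf k))) < \<epsilon> / 2"
    by (elim exE conjE) (rule that)
  show "\<exists>\<delta>>0. \<forall>d S. d division_of S \<and> S \<subseteq> {a..b} \<and> (\<Sum>k\<in>d. Sup k - Inf k) < \<delta> \<longrightarrow>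
        (\<Sum>k\<in>d. norm (x (Sup k) - y (Sup k) - (x (Inf k) - y (Inf k)))) < \<epsilon>"
  proof (intro exI conjI allI impI)
    show "min \<delta> \<delta>' > 0" using \<delta>(1) \<delta>'(1) by simp
    fix d S
    assume "d division_of S \<and> S \<subseteq> {a..b} \<and> (\<Sum>k\<in>d. Sup k - Inf k) < min \<delta> \<delta>'"
    then have d: "d division_of S" "S \<subseteq> {a..b}"
      "(\<Sum>k\<in>d. Sup k - Inf k) < \<delta>" "(\<Sum>k\<in>d. Sup k - Inf k) < \<delta>'" by auto
    have "(\<Sum>k\<in>d. norm (x (Sup k) - y (Sup k) - (x (Inf k) - y (Inf k)))) \<le>
          (\<Sum>k\<in>d. norm (x (Sup k) - x (Inf k)) + norm (y (Sup k) - y (Inf k)))"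
    proof (rule sum_mono)
      fix k
      have "x (Sup k) - y (Sup k) - (x (Inf k) - y (Inf k)) =
            (x (Sup k) - x (Inf k)) - (y (Sup k) - y (Inf k))"
        by (simp add: algebra_simps)
      then show "norm (x (Sup k) - y (Sup k) - (x (Inf k) - y (Inf k))) \<le>
            norm (x (Sup k) - x (Inf k)) + norm (y (Sup k) - y (Inf k))"
        by (metis norm_triangle_ineq4)
    qed
    also have "\<dots> < \<epsilon> / 2 + \<epsilon> / 2"
      unfolding sum.distrib using \<delta>(2)[rule_format, of d S] \<delta>'(2)[rule_format, of d S] d by (intro add_strict_mono) blast+
    finally show "(\<Sum>k\<in>d. norm (x (Sup k) - y (Sup k) - (x (Inf k) - y (Inf k)))) < \<epsilon>" by simp
  qed
qed

lemma abs_continuous_on_imp_continuous_on: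
  assumes x: "abs_continuous_on a b x"
  shows "continuous_on {a..b} x"
  unfolding continuous_on_iff
proof (intro ballI allI impI)
  fix t \<epsilon> :: real assume t: "t \<in> {a..b}" and "\<epsilon> > 0"
  from abs_continuous_onD[OF x this(2)] obtain \<delta> where \<delta>: "\<delta> > 0"
    "\<forall>d S. d division_of S \<and> S \<subseteq> {a..b} \<and> (\<Sum>k\<in>d. Sup k - Inf k) < \<delta> \<longrightarrow>
        (\<Sum>k\<in>d. norm (x (Sup k) - x (Inf k))) < \<epsilon>"
    by (elim exE conjE) (rule that)
  have close: "norm (x q - x p) < \<epsilon>" if "a \<le> p" "p \<le> q" "q \<le> b" "q - p < \<delta>" for p q
    using \<delta>(2)[rule_format, of "{{p..q}}" "{p..q}"] that division_of_self[of p q] by simp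
  show "\<exists>\<delta>>0. \<forall>s\<in>{a..b}. dist s t < \<delta> \<longrightarrow> dist (x s) (x t) < \<epsilon>"
  proof (intro exI conjI ballI impI)
    fix s assume "s \<in> {a..b}" "dist s t < \<delta>"
    then show "dist (x s) (x t) < \<epsilon>"
      using close[of s t] close[of t s] t
      by (cases "s \<le> t") (simp_all add: dist_norm norm_minus_commute[of "x s"])
  qed (use \<delta> in auto)
qed

text \<open>
  The exceptional null set \<open>N\<close> is covered by an open set \<open>U\<close> so small that, by absolute continuity,
  the variation of \<open>u\<close> over intervals inside \<open>U\<close> is at most \<open>\<epsilon>\<close>. Let \<open>G t\<close> be the variation
  of \<open>u\<close> over \<open>U \<inter> {a..t}\<close>. The inequality \<open>u t \<le> u a + \<epsilon> (t - a) + G t\<close> then propagates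
  from \<open>a\<close> to \<open>b\<close>: at a point outside \<open>N\<close> the derivative bound pays for a step to the right out of
  \<open>\<epsilon> (t - a)\<close>, at a point of \<open>N\<close> the growth of \<open>G\<close> pays for it. At \<open>b\<close> this leaves an error of
  \<open>\<epsilon> (b - a) + \<epsilon>\<close>, which is arbitrarily small. At \<open>t = b\<close> the hypothesis is vacuous, as the
  filter is trivial there.
\<close>

lemma abs_continuous_on_nonincreasing:
  fixes u :: "real \<Rightarrow> real"
  assumes "a \<le> b" and u: "abs_continuous_on a b u"
    and dini: "AE t in lebesgue_on {a..b}. \<forall>\<epsilon>>0. \<forall>\<^sub>F s in at t within {t..b}. u s \<le> u t + \<epsilon> * (s - t)"
  shows "u b \<le> u a"
proof -
  obtain N where N: "N \<in> null_sets lebesgue"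
    and DN: "\<And>t \<epsilon>. t \<in> {a..b} - N \<Longrightarrow> \<epsilon> > 0 \<Longrightarrow> \<forall>\<^sub>F s in at t within {t..b}. u s \<le> u t + \<epsilon> * (s - t)"
  proof -
    from dini obtain N where "N \<in> null_sets (lebesgue_on {a..b})"
      "{t \<in> space (lebesgue_on {a..b}). \<not> (\<forall>\<epsilon>>0. \<forall>\<^sub>F s in at t within {t..b}. u s \<le> u t + \<epsilon> * (s - t))} \<subseteq> N"
      unfolding eventually_ae_filter by blast
    then show thesis
      using that[of N] by (auto simp: null_sets_restrict_space space_restrict_space)
  qed
  have main: "u b \<le> u a + (\<epsilon> * (b - a) + \<epsilon>)" if "\<epsilon> > 0" for \<epsilon>
  proof -
    from abs_continuous_onD[OF u \<open>\<epsilon> > 0\<close>] obtain \<delta> where \<delta>: "\<delta> > 0"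
      "\<forall>d S. d division_of S \<and> S \<subseteq> {a..b} \<and> (\<Sum>k\<in>d. Sup k - Inf k) < \<delta> \<longrightarrow>
          (\<Sum>k\<in>d. norm (u (Sup k) - u (Inf k))) < \<epsilon>"
      by (elim exE conjE) (rule that)
    obtain U where U: "open U" "N \<subseteq> U" "emeasure lebesgue (U - N) < ennreal \<delta>" "U - N \<in> lmeasurable"
      using sets_lebesgue_outer_open[of N \<delta>] N \<delta>(1) by auto
    have Uset: "U \<in> sets lebesgue"
      using \<open>open U\<close> by (simp add: borel_open)
    have emU: "emeasure lebesgue U < ennreal \<delta>"
      using U(3) emeasure_Diff_null_set[OF N Uset] by simp
    then have Umeas: "U \<in> lmeasurable"
      using Uset by (intro fmeasurableI) (auto intro: less_trans)
    have mU: "measure lebesgue U < \<delta>"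
      using emU \<delta>(1) emeasure_eq_measure2[OF Umeas] by (simp add: ennreal_less_iff)
    \<comment> \<open>The variation is a supremum over finite families of intervals, so that it grows at once by
      \<open>\<bar>u s - u c\<bar>\<close> when an interval \<open>{c..s} \<subseteq> U\<close> is appended.\<close>
    define F where "F t = {(\<Sum>k\<in>d. \<bar>u (Sup k) - u (Inf k)\<bar>) | d. \<exists>S. d division_of S \<and> S \<subseteq> U \<inter> {a..t}}" for t
    have F_I: "(\<Sum>k\<in>d. \<bar>u (Sup k) - u (Inf k)\<bar>) \<in> F t"
      if "d division_of S" "S \<subseteq> U \<inter> {a..t}" for d S t
      unfolding F_def using that by (intro CollectI exI conjI) (rule refl)
    define G where "G t = Sup (F t)" for t
    have F_bound: "r < \<epsilon>" if r: "r \<in> F t" and t: "t \<le> b" for r t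
    proof -
      obtain d S where d: "d division_of S" "S \<subseteq> U \<inter> {a..t}" "r = (\<Sum>k\<in>d. \<bar>u (Sup k) - u (Inf k)\<bar>)"
        using r unfolding F_def by blast
      have Sab: "S \<subseteq> {a..b}" using d(2) t by auto
      have "(\<Sum>k\<in>d. Sup k - Inf k) = (\<Sum>k\<in>d. measure lebesgue k)"
      proof (rule sum.cong)
        fix k assume "k \<in> d"
        from d(1) this Sab obtain p q where "k = {p..q}" "p \<le> q" "Inf k = p" "Sup k = q"
          by (rule division_of_real_elem)
        then show "Sup k - Inf k = measure lebesgue k" by simp
      qed simp
      also have "\<dots> = measure lebesgue S"
        by (rule content_division[OF d(1)])
      also have "\<dots> \<le> measure lebesgue U"
        using d lmeasurable_division[OF d(1)] Umeas by (intro measure_mono_fmeasurable) auto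
      finally have "(\<Sum>k\<in>d. Sup k - Inf k) < \<delta>" using mU by simp
      with \<delta>(2) d(1) Sab have "(\<Sum>k\<in>d. norm (u (Sup k) - u (Inf k))) < \<epsilon>" by blast
      then show ?thesis using d(3) by simp
    qed
    have F0: "0 \<in> F t" for t
      using F_I[of "{}" "{}"] by simp
    have bdd: "bdd_above (F t)" if "t \<le> b" for t
      using F_bound[OF _ that] by (meson bdd_aboveI less_imp_le)
    have G_le: "G t \<le> \<epsilon>" if "t \<le> b" for t
      unfolding G_def using F0 F_bound[OF _ that] by (intro cSup_least) (auto intro: less_imp_le)
    have G_ge0: "0 \<le> G t" if "t \<le> b" for t
      unfolding G_def using F0 bdd[OF that] by (rule cSup_upper)
    have G_mono: "G s \<le> G t" if "s \<le> t" "t \<le> b" for s t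
    proof -
      have "F s \<subseteq> F t"
      proof
        fix r assume "r \<in> F s"
        then obtain d S where d: "d division_of S" "S \<subseteq> U \<inter> {a..s}" "r = (\<Sum>k\<in>d. \<bar>u (Sup k) - u (Inf k)\<bar>)"
          unfolding F_def by blast
        have "S \<subseteq> U \<inter> {a..t}" using d(2) \<open>s \<le> t\<close> by (auto intro: order_trans)
        then show "r \<in> F t" unfolding d(3) by (rule F_I[OF d(1)])
      qed
      then show ?thesis
        unfolding G_def using F0 bdd[OF \<open>t \<le> b\<close>] by (intro cSup_subset_mono) auto
    qed
    have G_step: "G c + \<bar>u s - u c\<bar> \<le> G s" if "a \<le> c" "c < s" "s \<le> b" "{c..s} \<subseteq> U" for c s
    proof -
      have "r \<le> G s - \<bar>u s - u c\<bar>" if r: "r \<in> F c" for r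
      proof -
        obtain d S where d: "d division_of S" "S \<subseteq> U \<inter> {a..c}" "r = (\<Sum>k\<in>d. \<bar>u (Sup k) - u (Inf k)\<bar>)"
          using r unfolding F_def by blast
        have "interior S \<inter> interior {c..s} \<subseteq> interior ({a..c} \<inter> {c..s})"
          unfolding interior_Int using d(2) by (intro Int_mono interior_mono order_refl) blast
        also have "\<dots> \<subseteq> interior {c}"
          by (rule interior_mono) auto
        finally have "interior S \<inter> interior {c..s} = {}" by simp
        moreover have "{{c..s}} division_of {c..s}"
          using division_of_self[of c s] \<open>c < s\<close> by simp
        ultimately have div: "(d \<union> {{c..s}}) division_of (S \<union> {c..s})"
          using d(1) by (intro division_disjoint_union)
        have sub: "S \<union> {c..s} \<subseteq> U \<inter> {a..s}"
          using d(2) \<open>{c..s} \<subseteq> U\<close> \<open>a \<le> c\<close> \<open>c < s\<close> by force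
        have "{c..s} \<notin> d"
        proof
          assume "{c..s} \<in> d"
          then have "{c..s} \<subseteq> {a..c}" using d division_ofD(2)[OF d(1)] by blast
          then show False using \<open>c < s\<close> by simp
        qed
        then have "(\<Sum>k\<in>d \<union> {{c..s}}. \<bar>u (Sup k) - u (Inf k)\<bar>) = r + \<bar>u s - u c\<bar>"
          using d(3) division_ofD(1)[OF d(1)] \<open>c < s\<close> by simp
        then have "r + \<bar>u s - u c\<bar> \<in> F s"
          using F_I[OF div sub] by simp
        then have "r + \<bar>u s - u c\<bar> \<le> G s"
          unfolding G_def using bdd[OF \<open>s \<le> b\<close>] by (rule cSup_upper)
        then show ?thesis by simp
      qed
      then have "G c \<le> G s - \<bar>u s - u c\<bar>"
        unfolding G_def using F0 by (intro cSup_least) auto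
      then show ?thesis by simp
    qed
    \<comment> \<open>Continuation argument: the supremum of the points where the inequality holds is attained, by left
      continuity of \<open>u\<close> and monotonicity of \<open>G\<close>, and it cannot lie to the left of \<open>b\<close>.\<close>
    define A where "A = {t \<in> {a..b}. u t \<le> u a + \<epsilon> * (t - a) + G t}"
    define c where "c = Sup A"
    have aA: "a \<in> A" unfolding A_def using \<open>a \<le> b\<close> G_ge0[of a] by simp
    have Abdd: "bdd_above A" unfolding A_def by (auto intro: bdd_aboveI[of _ b])
    have c: "a \<le> c" "c \<le> b"
    proof -
      show "a \<le> c" unfolding c_def using aA Abdd by (rule cSup_upper)
      have "A \<noteq> {}" using aA by blast
      then show "c \<le> b" unfolding c_def by (rule cSup_least) (simp add: A_def)
    qed
    have cA: "c \<in> A"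
    proof -
      have "u c \<le> u a + \<epsilon> * (c - a) + G c + \<eta>" if "\<eta> > 0" for \<eta>
      proof -
        have "c \<in> {a..b}" using c by simp
        with abs_continuous_on_imp_continuous_on[OF u] that
        have "\<exists>\<rho>>0. \<forall>s\<in>{a..b}. dist s c < \<rho> \<longrightarrow> dist (u s) (u c) < \<eta>"
          unfolding continuous_on_iff by blast
        then obtain \<rho> where \<rho>: "\<rho> > 0" "\<forall>s\<in>{a..b}. dist s c < \<rho> \<longrightarrow> dist (u s) (u c) < \<eta>"
          by blast
        obtain t where t: "t \<in> A" "c - \<rho> < t"
          using less_cSupE[of "c - \<rho>" A] aA \<rho>(1) unfolding c_def by auto
        have tc: "t \<le> c" unfolding c_def using t(1) Abdd by (rule cSup_upper)
        have "dist (u t) (u c) < \<eta>"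
          using \<rho>(2)[rule_format, of t] t tc unfolding A_def by (auto simp: dist_real_def)
        then have "u c \<le> u t + \<eta>" by (auto simp: dist_real_def)
        also have "u t \<le> u a + \<epsilon> * (t - a) + G t" using t(1) by (simp add: A_def)
        also have "\<dots> \<le> u a + \<epsilon> * (c - a) + G c"
          using G_mono[OF tc c(2)] tc \<open>\<epsilon> > 0\<close> by (intro add_mono mult_left_mono) auto
        finally show ?thesis by simp
      qed
      then have "u c \<le> u a + \<epsilon> * (c - a) + G c" by (rule field_le_epsilon)
      then show ?thesis using c by (simp add: A_def)
    qed
    have "c = b"
    proof (rule ccontr)
      assume "c \<noteq> b"
      with c have "c < b" by simp
      have "\<exists>s. c < s \<and> s \<le> b \<and> u s \<le> u c + \<epsilon> * (s - c) + (G s - G c)"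
      proof (cases "c \<in> N")
        case True
        with U have "c \<in> U" by blast
        with \<open>open U\<close> obtain r where r: "r > 0" "cball c r \<subseteq> U"
          by (meson open_contains_cball)
        define s where "s = min b (c + r)"
        have s: "c < s" "s \<le> b" "{c..s} \<subseteq> U"
          using r \<open>c < b\<close> by (auto simp: s_def subset_iff dist_real_def)
        have "u s \<le> u c + \<bar>u s - u c\<bar>" by simp
        also have "\<dots> \<le> u c + (G s - G c)" using G_step[OF c(1) s] by simp
        also have "\<dots> \<le> u c + \<epsilon> * (s - c) + (G s - G c)" using s \<open>\<epsilon> > 0\<close> by simp
        finally show ?thesis using s by blast
      next
        case False
        with c have "\<forall>\<^sub>F s in at c within {c..b}. u s \<le> u c + \<epsilon> * (s - c)"
          using DN[of c \<epsilon>] \<open>\<epsilon> > 0\<close> by auto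
        then obtain r where r: "r > 0" "\<And>s. s \<in> {c..b} \<Longrightarrow> s \<noteq> c \<Longrightarrow> dist s c < r \<Longrightarrow> u s \<le> u c + \<epsilon> * (s - c)"
          unfolding eventually_at by blast
        define s where "s = min b (c + r / 2)"
        have s: "c < s" "s \<le> b" "dist s c < r"
          using r(1) \<open>c < b\<close> by (auto simp: s_def dist_real_def)
        then have "u s \<le> u c + \<epsilon> * (s - c)" using r(2)[of s] by auto
        also have "\<dots> \<le> u c + \<epsilon> * (s - c) + (G s - G c)" using G_mono[of c s] s by simp
        finally show ?thesis using s by blast
      qed
      then obtain s where s: "c < s" "s \<le> b" "u s \<le> u c + \<epsilon> * (s - c) + (G s - G c)" by blast
      then have "u s \<le> u a + \<epsilon> * (c - a) + G c + \<epsilon> * (s - c) + (G s - G c)"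
        using cA by (simp add: A_def)
      also have "\<dots> = u a + \<epsilon> * (s - a) + G s" by (simp add: algebra_simps)
      finally have "s \<in> A" using s c by (simp add: A_def)
      then have "s \<le> c" unfolding c_def using Abdd by (rule cSup_upper)
      with s show False by simp
    qed
    then show ?thesis using cA G_le[of b] by (simp add: A_def)
  qed
  show ?thesis
  proof (rule field_le_epsilon)
    fix e :: real assume "e > 0"
    have "u b \<le> u a + (e / (b - a + 1) * (b - a) + e / (b - a + 1))"
      using \<open>e > 0\<close> \<open>a \<le> b\<close> by (intro main) simp
    also have "e / (b - a + 1) * (b - a) + e / (b - a + 1) = e / (b - a + 1) * (b - a + 1)"
      by (simp only: distrib_left mult_1_right)
    also have "\<dots> = e" using \<open>a \<le> b\<close> by simp
    finally show "u b \<le> u a + e" .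
  qed
qed

section \<open>A differential inequality for the supremum norm\<close>

text \<open>
  Up to an error \<open>o(s - t)\<close> the curve follows its tangent, so the growth of the norm along the tangent
  controls the upper right derivative of the norm, which itself need not be differentiable.
\<close>

lemma infnorm_upper_dini:
  fixes d :: "real \<Rightarrow> 'a::euclidean_space"
  assumes D: "(d has_vector_derivative D) (at t within {a..b})" and "a \<le> t"
    and step: "\<forall>\<^sub>F h in at_right 0. infnorm (d t + h *\<^sub>R D) \<le> infnorm (d t) + h * r"
    and "\<eta> > 0"
  shows "\<forall>\<^sub>F s in at t within {t..b}. infnorm (d s) \<le> infnorm (d t) + (s - t) * (r + \<eta>)"
proof -
  have "(d has_vector_derivative D) (at t within {t..b})"
    using D by (rule has_vector_derivative_within_subset) (use \<open>a \<le> t\<close> in auto)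
  then obtain \<delta> where \<delta>: "\<delta> > 0"
    "\<And>s. s \<in> {t..b} \<Longrightarrow> \<bar>s - t\<bar> < \<delta> \<Longrightarrow> norm (d s - d t - (s - t) *\<^sub>R D) \<le> \<eta> * \<bar>s - t\<bar>"
    using \<open>\<eta> > 0\<close> unfolding has_vector_derivative_def has_derivative_within_alt by (metis real_norm_def)
  obtain h0 where h0: "h0 > 0" "\<And>h. 0 < h \<Longrightarrow> h < h0 \<Longrightarrow> infnorm (d t + h *\<^sub>R D) \<le> infnorm (d t) + h * r"
    using step unfolding eventually_at_right_field by auto
  show ?thesis
    unfolding eventually_at
  proof (intro exI conjI ballI impI)
    show "min \<delta> h0 > 0" using \<delta> h0 by simp
    fix s assume s: "s \<in> {t..b}" "s \<noteq> t \<and> dist s t < min \<delta> h0"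
    have "infnorm (d s) = infnorm ((d t + (s - t) *\<^sub>R D) + (d s - d t - (s - t) *\<^sub>R D))"
      by simp
    also have "\<dots> \<le> infnorm (d t + (s - t) *\<^sub>R D) + infnorm (d s - d t - (s - t) *\<^sub>R D)"
      by (rule infnorm_triangle)
    also have "\<dots> \<le> (infnorm (d t) + (s - t) * r) + \<eta> * \<bar>s - t\<bar>"
      using s h0(2)[of "s - t"] \<delta>(2)[of s] infnorm_le_norm[of "d s - d t - (s - t) *\<^sub>R D"]
      by (intro add_mono) (auto simp: dist_real_def)
    also have "\<dots> = infnorm (d t) + (s - t) * (r + \<eta>)"
      using s by (simp add: algebra_simps)
    finally show "infnorm (d s) \<le> infnorm (d t) + (s - t) * (r + \<eta>)" .
  qed
qed

text \<open>
  Gronwall's inequality for \<open>e = infnorm \<circ> d\<close>, where \<open>e' \<le> \<Lambda> e + c\<close> holds in the sense of upper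
  right derivatives almost everywhere. With the integrating factor \<open>p t = exp (- \<Lambda> (t - a))\<close> and its
  primitive \<open>\<psi>\<close>, the function \<open>u = p e - c \<psi>\<close> is absolutely continuous and has upper right
  derivative at most \<open>0\<close> almost everywhere, hence \<open>u b \<le> u a\<close>; the factor \<open>phi\<close> appears because
  \<open>exp (\<Lambda> (b - a)) \<psi> b = (b - a) phi (\<Lambda> (b - a))\<close>. The growth hypothesis is stated for one Euler
  step, the form in which a logarithmic norm enters.
\<close>

lemma infnorm_gronwall:
  fixes d :: "real \<Rightarrow> 'a::euclidean_space"
  assumes "a \<le> b" and d: "abs_continuous_on a b d"
    and step: "AE t in lebesgue_on {a..b}. \<exists>D. (d has_vector_derivative D) (at t within {a..b}) \<and>
      (\<forall>\<^sub>F h in at_right 0. infnorm (d t + h *\<^sub>R D) \<le> infnorm (d t) + h * (\<Lambda> * infnorm (d t) + c))"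
  shows "infnorm (d b) \<le> exp (\<Lambda> * (b - a)) * infnorm (d a) + (b - a) * c * phi (\<Lambda> * (b - a))"
proof -
  define p where "p t = exp (- \<Lambda> * (t - a))" for t
  define \<psi> where "\<psi> t = (if \<Lambda> = 0 then t - a else (1 - p t) / \<Lambda>)" for t
  define u where "u t = p t * infnorm (d t) - c * \<psi> t" for t
  have p': "(p has_real_derivative - \<Lambda> * p t) (at t within S)" for t S
    unfolding p_def by (auto intro!: derivative_eq_intros)
  have \<psi>': "(\<psi> has_real_derivative p t) (at t within S)" for t S
  proof (cases "\<Lambda> = 0")
    case True
    then show ?thesis
      unfolding \<psi>_def p_def by (auto intro!: derivative_eq_intros)
  next
    case False
    then show ?thesis
      unfolding \<psi>_def by (auto intro!: derivative_eq_intros p')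
  qed
  have p_pos: "p t > 0" for t unfolding p_def by simp
  define P where "P = exp (\<bar>\<Lambda>\<bar> * (b - a))"
  have p_le: "\<bar>p t\<bar> \<le> P" if "t \<in> {a..b}" for t
  proof -
    have "- \<Lambda> * (t - a) \<le> \<bar>\<Lambda>\<bar> * (b - a)"
      using that by (intro mult_mono) auto
    then show ?thesis by (simp add: p_def P_def)
  qed
  obtain E where E: "\<And>t. t \<in> {a..b} \<Longrightarrow> infnorm (d t) \<le> E"
  proof -
    have "continuous_on {a..b} (\<lambda>t. infnorm (d t))"
      by (intro continuous_intros abs_continuous_on_imp_continuous_on d)
    then have "bounded ((\<lambda>t. infnorm (d t)) ` {a..b})"
      by (intro compact_imp_bounded compact_continuous_image) auto
    then show ?thesis
      using that unfolding bounded_iff by (metis abs_le_D1 image_eqI real_norm_def)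
  qed
  have "abs_continuous_on a b u"
  proof (rule abs_continuous_on_dominated[OF d])
    fix q s assume q: "a \<le> q" "q \<le> s" "s \<le> b"
    have "\<bar>- \<Lambda> * p t\<bar> \<le> \<bar>\<Lambda>\<bar> * P" if "t \<in> {a..b}" for t
      using p_le[OF that] by (simp add: abs_mult mult_left_mono)
    then have dp: "\<bar>p s - p q\<bar> \<le> \<bar>\<Lambda>\<bar> * P * (s - q)"
      using field_differentiable_bound[of "{a..b}" p "\<lambda>t. - \<Lambda> * p t" "\<bar>\<Lambda>\<bar> * P" s q] p' q by auto
    have d\<psi>: "\<bar>\<psi> s - \<psi> q\<bar> \<le> P * (s - q)"
      using field_differentiable_bound[of "{a..b}" \<psi> p P s q] \<psi>' p_le q by auto
    have de: "\<bar>infnorm (d s) - infnorm (d q)\<bar> \<le> norm (d s - d q)"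
      using absdiff_infnorm[of "d s" "d q"] infnorm_le_norm[of "d s - d q"] by linarith
    have "u s - u q = p s * (infnorm (d s) - infnorm (d q)) + infnorm (d q) * (p s - p q) - c * (\<psi> s - \<psi> q)"
      by (simp add: u_def algebra_simps)
    then have "\<bar>u s - u q\<bar> \<le> \<bar>p s * (infnorm (d s) - infnorm (d q))\<bar> + \<bar>infnorm (d q) * (p s - p q)\<bar>
        + \<bar>c * (\<psi> s - \<psi> q)\<bar>" by linarith
    also have "\<dots> \<le> P * norm (d s - d q) + E * (\<bar>\<Lambda>\<bar> * P * (s - q)) + \<bar>c\<bar> * (P * (s - q))"
      unfolding abs_mult
      using p_le[of s] de dp d\<psi> q E[of q] infnorm_pos_le[of "d q"]
      by (intro add_mono mult_mono) (auto simp: P_def)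
    finally show "norm (u s - u q) \<le> P * norm (d s - d q) + (E * \<bar>\<Lambda>\<bar> * P + \<bar>c\<bar> * P) * (s - q)"
      by (simp add: algebra_simps)
  qed
  moreover have "AE t in lebesgue_on {a..b}. \<forall>\<epsilon>>0. \<forall>\<^sub>F s in at t within {t..b}. u s \<le> u t + \<epsilon> * (s - t)"
    using step AE_space
  proof (eventually_elim, intro allI impI)
    fix t \<epsilon> :: real
    assume ex: "\<exists>D. (d has_vector_derivative D) (at t within {a..b}) \<and>
      (\<forall>\<^sub>F h in at_right 0. infnorm (d t + h *\<^sub>R D) \<le> infnorm (d t) + h * (\<Lambda> * infnorm (d t) + c))"
    assume "t \<in> space (lebesgue_on {a..b})" "\<epsilon> > 0"
    then have "a \<le> t" by simp
    \<comment> \<open>Near \<open>t\<close>, \<open>u\<close> lies below the differentiable function \<open>R\<close>, which agrees with it at \<open>t\<close> and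
      has slope \<open>p t * \<eta>\<close> there; \<open>\<eta>\<close> is chosen to make this slope \<open>\<epsilon> / 2 < \<epsilon>\<close>.\<close>
    define \<eta> where "\<eta> = \<epsilon> / (2 * p t)"
    have "\<eta> > 0" using \<open>\<epsilon> > 0\<close> p_pos[of t] by (simp add: \<eta>_def)
    define r where "r = \<Lambda> * infnorm (d t) + c"
    define R where "R s = p s * (infnorm (d t) + (s - t) * (r + \<eta>)) - c * \<psi> s" for s
    have 1: "\<forall>\<^sub>F s in at t within {t..b}. infnorm (d s) \<le> infnorm (d t) + (s - t) * (r + \<eta>)"
      using ex infnorm_upper_dini[OF _ \<open>a \<le> t\<close> _ \<open>\<eta> > 0\<close>, of d _ b r] unfolding r_def by blast
    have "(R has_real_derivative (- \<Lambda> * p t * infnorm (d t) + p t * (r + \<eta>) - c * p t)) (at t within {t..b})"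
      unfolding R_def by (auto intro!: derivative_eq_intros p' \<psi>')
    also have "- \<Lambda> * p t * infnorm (d t) + p t * (r + \<eta>) - c * p t = \<epsilon> / 2"
      using p_pos[of t] by (simp add: r_def \<eta>_def field_simps)
    finally have "((\<lambda>s. (R s - R t) / (s - t)) \<longlongrightarrow> \<epsilon> / 2) (at t within {t..b})"
      by (simp add: has_field_derivative_iff)
    then have 2: "\<forall>\<^sub>F s in at t within {t..b}. (R s - R t) / (s - t) < \<epsilon>"
      by (rule order_tendstoD) (use \<open>\<epsilon> > 0\<close> in simp)
    have 3: "\<forall>\<^sub>F s in at t within {t..b}. s \<in> {t<..b}"
      unfolding eventually_at by (auto intro!: exI[of _ 1])
    from 1 2 3 show "\<forall>\<^sub>F s in at t within {t..b}. u s \<le> u t + \<epsilon> * (s - t)"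
    proof eventually_elim
      case (elim s)
      have "u s \<le> R s"
        unfolding u_def R_def using elim(1) p_pos[of s] by (simp add: less_imp_le mult_left_mono)
      also have "R s \<le> R t + \<epsilon> * (s - t)"
        using elim(2,3) by (simp add: divide_less_eq)
      also have "R t = u t" by (simp add: R_def u_def)
      finally show ?case .
    qed
  qed
  ultimately have "u b \<le> u a"
    by (rule abs_continuous_on_nonincreasing[OF \<open>a \<le> b\<close>])
  moreover have "p a = 1" by (simp add: p_def)
  moreover from this have "\<psi> a = 0" by (simp add: \<psi>_def)
  ultimately have "p b * infnorm (d b) \<le> infnorm (d a) + c * \<psi> b"
    by (simp add: u_def)
  then have "exp (\<Lambda> * (b - a)) * (p b * infnorm (d b)) \<le> exp (\<Lambda> * (b - a)) * (infnorm (d a) + c * \<psi> b)"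
    by simp
  then have fin: "(exp (\<Lambda> * (b - a)) * p b) * infnorm (d b) \<le>
      exp (\<Lambda> * (b - a)) * infnorm (d a) + c * (exp (\<Lambda> * (b - a)) * \<psi> b)"
    by (simp only: distrib_left mult.assoc mult.left_commute)
  have inv: "exp (\<Lambda> * (b - a)) * p b = 1"
    by (simp add: p_def flip: exp_add)
  have "exp (\<Lambda> * (b - a)) * \<psi> b = (b - a) * phi (\<Lambda> * (b - a))"
  proof (cases "\<Lambda> = 0 \<or> b = a")
    case True
    then show ?thesis by (auto simp: \<psi>_def phi_def p_def)
  next
    case False
    then have "exp (\<Lambda> * (b - a)) * \<psi> b = (exp (\<Lambda> * (b - a)) - exp (\<Lambda> * (b - a)) * p b) / \<Lambda>"
      by (simp add: \<psi>_def right_diff_distrib)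
    also have "\<dots> = (b - a) * phi (\<Lambda> * (b - a))"
      unfolding inv using False by (simp add: phi_def)
    finally show ?thesis .
  qed
  with fin inv show ?thesis
    by (simp only: mult_1 mult.assoc mult.left_commute)
qed

section \<open>The logarithmic norm induced by the supremum norm\<close>

lemma infnorm_le_cart:
  fixes x :: "real ^ 'n"
  assumes "\<And>i. \<bar>x $ i\<bar> \<le> c"
  shows "infnorm x \<le> c"
  unfolding infnorm_cart using assms by (intro cSup_least) auto

text \<open>
  The maximum is attained at the vector of signs of a row with the largest sum of absolute values.
\<close>

lemma mat_infnorm_eq_Max_row_sum:
  fixes P :: "real ^ 'n ^ 'n"
  shows "mat_infnorm P = Max (range (\<lambda>k. \<Sum>i\<in>UNIV. \<bar>P $ k $ i\<bar>))" (is "_ = ?R")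
  unfolding mat_infnorm_def
proof (rule cSup_eq_maximum)
  have row: "(\<Sum>i\<in>UNIV. \<bar>P $ k $ i\<bar>) \<le> ?R" for k by (rule Max_ge) auto
  have upper: "infnorm (P *v x) / infnorm x \<le> ?R" for x
  proof (cases "x = 0")
    case True
    have "0 \<le> ?R" using order_trans[OF _ row] by (meson abs_ge_zero sum_nonneg)
    with True show ?thesis by (simp add: infnorm_0)
  next
    case False
    have "infnorm (P *v x) \<le> ?R * infnorm x"
    proof (rule infnorm_le_cart)
      fix k
      have "\<bar>(P *v x) $ k\<bar> \<le> (\<Sum>i\<in>UNIV. \<bar>P $ k $ i\<bar> * infnorm x)"
        unfolding matrix_vector_mul_component inner_vec_def
        by (auto simp: abs_mult component_le_infnorm_cart intro!: order_trans[OF sum_abs] sum_mono mult_left_mono)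
      also have "\<dots> \<le> ?R * infnorm x"
        unfolding sum_distrib_right[symmetric] by (rule mult_right_mono[OF row infnorm_pos_le])
      finally show "\<bar>(P *v x) $ k\<bar> \<le> ?R * infnorm x" .
    qed
    then show ?thesis using False by (simp add: divide_le_eq infnorm_pos_lt)
  qed
  then show "y \<le> ?R" if "y \<in> range (\<lambda>x. infnorm (P *v x) / infnorm x)" for y using that by blast
  have "?R \<in> range (\<lambda>k. \<Sum>i\<in>UNIV. \<bar>P $ k $ i\<bar>)" by (rule Max_in) auto
  then obtain k where k: "?R = (\<Sum>i\<in>UNIV. \<bar>P $ k $ i\<bar>)" by blast
  define x :: "real ^ 'n" where "x = (\<chi> i. if P $ k $ i \<ge> 0 then 1 else -1)"
  have "infnorm x = 1"
    using component_le_infnorm_cart[of x k]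
    by (intro antisym infnorm_le_cart) (auto simp: x_def split: if_splits)
  moreover have "?R \<le> infnorm (P *v x)"
  proof -
    have "(P *v x) $ k = ?R"
      unfolding matrix_vector_mul_component inner_vec_def k by (intro sum.cong) (auto simp: x_def)
    then show ?thesis using component_le_infnorm_cart[of "P *v x" k] by linarith
  qed
  ultimately have "?R = infnorm (P *v x) / infnorm x"
    using upper[of x] by (metis antisym div_by_1)
  then show "?R \<in> range (\<lambda>x. infnorm (P *v x) / infnorm x)" by blast
qed

text \<open>
  As soon as \<open>h\<close> is so small that the diagonal of \<open>mat 1 + h *\<^sub>R Q\<close> is nonnegative, its row sums of
  absolute values are affine in \<open>h\<close> and the difference quotient in the definition of the logarithmic
  norm is constant; in particular the limit exists.
\<close>

lemma log_norm_eq_Max_row: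
  fixes Q :: "real ^ 'n ^ 'n"
  shows "log_norm Q = Max (range (\<lambda>k. Q $ k $ k + (\<Sum>i\<in>UNIV - {k}. \<bar>Q $ k $ i\<bar>)))" (is "_ = Max (range ?r)")
proof -
  have ev: "\<forall>\<^sub>F h in at_right 0. \<forall>k. 0 \<le> 1 + h * Q $ k $ k"
  proof (rule eventually_all_finite)
    fix k
    have "((\<lambda>h. 1 + h * Q $ k $ k) \<longlongrightarrow> 1 + 0 * Q $ k $ k) (at_right 0)"
      by (intro tendsto_intros)
    then have "\<forall>\<^sub>F h in at_right 0. 0 < 1 + h * Q $ k $ k"
      by (rule order_tendstoD) simp
    then show "\<forall>\<^sub>F h in at_right 0. 0 \<le> 1 + h * Q $ k $ k"
      by eventually_elim simp
  qed
  have "\<forall>\<^sub>F h in at_right 0. (mat_infnorm (mat 1 + h *\<^sub>R Q) - 1) / h = Max (range ?r)"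
    using ev eventually_at_right_less[of 0]
  proof eventually_elim
    case (elim h)
    have row: "(\<Sum>i\<in>UNIV. \<bar>(mat 1 + h *\<^sub>R Q) $ k $ i\<bar>) = 1 + h * ?r k" for k
    proof -
      have "(\<Sum>i\<in>UNIV. \<bar>(mat 1 + h *\<^sub>R Q) $ k $ i\<bar>) =
        \<bar>(mat 1 + h *\<^sub>R Q) $ k $ k\<bar> + (\<Sum>i\<in>UNIV - {k}. \<bar>(mat 1 + h *\<^sub>R Q) $ k $ i\<bar>)"
        by (rule sum.remove) auto
      also have "(\<Sum>i\<in>UNIV - {k}. \<bar>(mat 1 + h *\<^sub>R Q) $ k $ i\<bar>) = (\<Sum>i\<in>UNIV - {k}. h * \<bar>Q $ k $ i\<bar>)"
        using elim(2) by (intro sum.cong) (auto simp: mat_def abs_mult)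
      also have "\<bar>(mat 1 + h *\<^sub>R Q) $ k $ k\<bar> = 1 + h * Q $ k $ k"
        using elim(1) by (simp add: mat_def)
      finally show ?thesis by (simp add: algebra_simps sum_distrib_left)
    qed
    have "mono (\<lambda>s. 1 + h * s)" using elim(2) by (auto intro!: monoI)
    from mono_Max_commute[OF this, of "range ?r"]
    have "mat_infnorm (mat 1 + h *\<^sub>R Q) = 1 + h * Max (range ?r)"
      unfolding mat_infnorm_eq_Max_row_sum row by (simp add: image_image)
    then show ?case using elim(2) by simp
  qed
  then have "((\<lambda>h. (mat_infnorm (mat 1 + h *\<^sub>R Q) - 1) / h) \<longlongrightarrow> Max (range ?r)) (at_right 0)"
    by (rule tendsto_eventually)
  then show ?thesis unfolding log_norm_def by (intro tendsto_Lim) auto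
qed

lemma row_le_log_norm: "Q $ k $ k + (\<Sum>i\<in>UNIV - {k}. \<bar>Q $ k $ i\<bar>) \<le> log_norm Q"
  unfolding log_norm_eq_Max_row by (rule Max_ge) auto

text \<open>
  There is no mean value equality for vector-valued maps; for a single component there is one, with an
  intermediate point that depends on the component.
\<close>

lemma component_mean_value:
  fixes f :: "real ^ 'n \<Rightarrow> real ^ 'm"
  assumes "\<And>z. z \<in> closed_segment y x \<Longrightarrow> f differentiable (at z)"
  obtains \<xi> where "\<xi> \<in> closed_segment y x" "f x $ k - f y $ k = (jacobian f (at \<xi>) *v (x - y)) $ k"
proof -
  define l where "l s = y + s *\<^sub>R (x - y)" for s :: real
  have l: "l s \<in> closed_segment y x" if "0 \<le> s" "s \<le> 1" for s
    using that unfolding l_def in_segment by (auto intro!: exI[of _ s] simp: algebra_simps)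
  have "\<exists>s\<in>{0..1}. f (l 1) $ k - f (l 0) $ k = (jacobian f (at (l s)) *v ((1 - 0) *\<^sub>R (x - y))) $ k"
  proof (rule mvt_very_simple)
    fix s :: real assume s: "0 \<le> s" "s \<le> 1"
    have "(f has_derivative (\<lambda>v. jacobian f (at (l s)) *v v)) (at (l s))"
      using assms[OF l[OF s]] by (simp add: jacobian_works)
    moreover have "(l has_derivative (\<lambda>h. h *\<^sub>R (x - y))) (at s within {0..1})"
      unfolding l_def by (auto intro!: derivative_eq_intros)
    ultimately have "((\<lambda>s. f (l s)) has_derivative (\<lambda>h. jacobian f (at (l s)) *v (h *\<^sub>R (x - y)))) (at s within {0..1})"
      by (rule has_derivative_compose[rotated])
    then show "((\<lambda>s. f (l s) $ k) has_derivative (\<lambda>h. (jacobian f (at (l s)) *v (h *\<^sub>R (x - y))) $ k)) (at s within {0..1})"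
      by (rule bounded_linear.has_derivative[OF bounded_linear_vec_nth])
  qed simp
  then obtain s where s: "s \<in> {0..1}"
    "f (l 1) $ k - f (l 0) $ k = (jacobian f (at (l s)) *v ((1 - 0) *\<^sub>R (x - y))) $ k" by blast
  show ?thesis
    by (rule that[of "l s"]) (use s l in \<open>auto simp: l_def\<close>)
qed

text \<open>
  The intermediate points belonging to different components may differ, since the estimate
  \<open>\<bar>(1 + h q\<^sub>k\<^sub>k) z\<^sub>k + h (\<Sum>i\<noteq>k. q\<^sub>k\<^sub>i z\<^sub>i)\<bar> \<le> (1 + h \<Lambda>) infnorm z\<close> with \<open>z = x - y\<close> involves
  only one row at a time. It needs \<open>1 + h q\<^sub>k\<^sub>k \<ge> 0\<close>, which holds for all small \<open>h\<close>, uniformly in the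
  finitely many rows.
\<close>

lemma infnorm_euler_step_le:
  fixes f :: "real ^ 'n \<Rightarrow> real ^ 'n"
  assumes diff: "\<And>z. z \<in> closed_segment y x \<Longrightarrow> f differentiable (at z)"
    and \<Lambda>: "\<And>z. z \<in> closed_segment y x \<Longrightarrow> log_norm (jacobian f (at z)) \<le> \<Lambda>"
  shows "\<forall>\<^sub>F h in at_right 0. infnorm ((x - y) + h *\<^sub>R (f x - f y)) \<le> (1 + h * \<Lambda>) * infnorm (x - y)"
proof -
  have "\<exists>q::real^'n. f x $ k - f y $ k = (\<Sum>i\<in>UNIV. q $ i * (x - y) $ i) \<and>
          q $ k + (\<Sum>i\<in>UNIV - {k}. \<bar>q $ i\<bar>) \<le> \<Lambda>" for k
  proof -
    obtain \<xi> where \<xi>: "\<xi> \<in> closed_segment y x" "f x $ k - f y $ k = (jacobian f (at \<xi>) *v (x - y)) $ k"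
      using component_mean_value[OF diff] by blast
    show ?thesis
      using \<xi>(2) order_trans[OF row_le_log_norm \<Lambda>[OF \<xi>(1)]]
      by (intro exI[of _ "jacobian f (at \<xi>) $ k"]) (auto simp: matrix_vector_mul_component inner_vec_def)
  qed
  then obtain q where q: "\<And>k. f x $ k - f y $ k = (\<Sum>i\<in>UNIV. q k $ i * (x - y) $ i)"
      "\<And>k. (q :: 'n \<Rightarrow> real ^ 'n) k $ k + (\<Sum>i\<in>UNIV - {k}. \<bar>q k $ i\<bar>) \<le> \<Lambda>" by metis
  have ev: "\<forall>\<^sub>F h in at_right 0. \<forall>k. 0 \<le> 1 + h * q k $ k"
  proof (rule eventually_all_finite)
    fix k
    have "((\<lambda>h. 1 + h * q k $ k) \<longlongrightarrow> 1 + 0 * q k $ k) (at_right 0)"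
      by (intro tendsto_intros)
    then have "\<forall>\<^sub>F h in at_right 0. 0 < 1 + h * q k $ k"
      by (rule order_tendstoD) simp
    then show "\<forall>\<^sub>F h in at_right 0. 0 \<le> 1 + h * q k $ k"
      by eventually_elim simp
  qed
  show ?thesis
    using ev eventually_at_right_less[of 0]
  proof eventually_elim
    case (elim h)
    show ?case
    proof (rule infnorm_le_cart)
      fix k
      define z where "z = x - y"
      have z: "\<bar>z $ i\<bar> \<le> infnorm z" for i by (rule component_le_infnorm_cart)
      have "(\<Sum>i\<in>UNIV. q k $ i * z $ i) = q k $ k * z $ k + (\<Sum>i\<in>UNIV - {k}. q k $ i * z $ i)"
        by (rule sum.remove) auto
      then have "(z + h *\<^sub>R (f x - f y)) $ k = (1 + h * q k $ k) * z $ k + h * (\<Sum>i\<in>UNIV - {k}. q k $ i * z $ i)"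
        using q(1)[of k] by (simp add: distrib_left distrib_right flip: z_def)
      also have "\<bar>\<dots>\<bar> \<le> \<bar>(1 + h * q k $ k) * z $ k\<bar> + \<bar>h * (\<Sum>i\<in>UNIV - {k}. q k $ i * z $ i)\<bar>"
        by (rule abs_triangle_ineq)
      also have "\<dots> \<le> (1 + h * q k $ k) * infnorm z + h * (\<Sum>i\<in>UNIV - {k}. \<bar>q k $ i\<bar> * infnorm z)"
      proof (rule add_mono)
        show "\<bar>(1 + h * q k $ k) * z $ k\<bar> \<le> (1 + h * q k $ k) * infnorm z"
          unfolding abs_mult using elim(1) z by (simp add: mult_left_mono)
        have "\<bar>\<Sum>i\<in>UNIV - {k}. q k $ i * z $ i\<bar> \<le> (\<Sum>i\<in>UNIV - {k}. \<bar>q k $ i\<bar> * infnorm z)"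
          by (rule order_trans[OF sum_abs]) (auto simp: abs_mult z intro!: sum_mono mult_left_mono)
        then show "\<bar>h * (\<Sum>i\<in>UNIV - {k}. q k $ i * z $ i)\<bar> \<le> h * (\<Sum>i\<in>UNIV - {k}. \<bar>q k $ i\<bar> * infnorm z)"
          using elim(2) by (simp add: abs_mult)
      qed
      also have "\<dots> = (1 + h * (q k $ k + (\<Sum>i\<in>UNIV - {k}. \<bar>q k $ i\<bar>))) * infnorm z"
        unfolding sum_distrib_right[symmetric] by (simp add: algebra_simps)
      also have "\<dots> \<le> (1 + h * \<Lambda>) * infnorm z"
        using q(2)[of k] elim(2) infnorm_pos_le[of z] by (intro mult_right_mono) auto
      finally show "\<bar>((x - y) + h *\<^sub>R (f x - f y)) $ k\<bar> \<le> (1 + h * \<Lambda>) * infnorm (x - y)"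
        by (simp add: z_def)
    qed
  qed
qed

section \<open>The local error of the drift approximation\<close>

lemma infnorm_sum_le: "infnorm (sum F S) \<le> (\<Sum>i\<in>S. infnorm (F i))"
proof (induction S rule: infinite_finite_induct)
  case (insert i S)
  then show ?case using infnorm_triangle[of "F i" "sum F S"] by simp
qed (auto simp: infnorm_0)

lemma infnorm_input_sum_le:
  assumes "\<And>i. i \<in> {1..m} \<Longrightarrow> v i \<in> {- V i..V i}" "\<And>i. i \<in> {1..m} \<Longrightarrow> infnorm (G i) \<le> Kg i"
  shows "infnorm (\<Sum>i=1..m. v i *\<^sub>R G i) \<le> (\<Sum>i=1..m. V i * Kg i)"
proof (rule order_trans[OF infnorm_sum_le], rule sum_mono)
  fix i assume i: "i \<in> {1..m}"
  have "\<bar>v i\<bar> \<le> V i" using assms(1)[OF i] by auto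
  then show "infnorm (v i *\<^sub>R G i) \<le> V i * Kg i"
    unfolding infnorm_mul using assms(2)[OF i] infnorm_pos_le[of "G i"] by (intro mult_mono) auto
qed

text \<open>
  The two solutions differ by a curve whose velocity is the drift difference plus the input term. The two
  bounds differ only in how the drift difference is estimated: by the logarithmic norm along the segment
  between the solutions, or by \<open>2 K\<close> irrespective of their distance.
\<close>

lemma drift_local_error:
  fixes f :: "real ^ 'n \<Rightarrow> real ^ 'n"
  assumes "a \<le> b"
    and diff: "\<And>z. z \<in> B \<Longrightarrow> f differentiable (at z)" and "convex B"
    and K: "\<And>z. z \<in> B \<Longrightarrow> infnorm (f z) \<le> K"
    and Kg: "\<And>z i. z \<in> B \<Longrightarrow> i \<in> {1..m} \<Longrightarrow> infnorm (g i z) \<le> Kg i"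
    and \<Lambda>: "\<And>z. z \<in> B \<Longrightarrow> log_norm (jacobian f (at z)) \<le> \<Lambda>"
    and v: "\<And>i t. i \<in> {1..m} \<Longrightarrow> t \<in> {a..b} \<Longrightarrow> v i t \<in> {- V i..V i}"
    and w: "\<And>i t. i \<in> {1..m} \<Longrightarrow> t \<in> {a..b} \<Longrightarrow> w i t = 0"
    and x: "affine_solution f m g v a b x" and y: "affine_solution f m g w a b y"
    and "x a = y a"
    and B: "\<And>t. t \<in> {a..b} \<Longrightarrow> x t \<in> B \<and> y t \<in> B"
  defines "K' \<equiv> \<Sum>i=1..m. V i * Kg i"
  shows "infnorm (x b - y b) \<le> (b - a) * K' * phi (\<Lambda> * (b - a))"
    and "infnorm (x b - y b) \<le> (b - a) * (2 * K + K')"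
proof -
  define I where "I t = (\<Sum>i=1..m. v i t *\<^sub>R g i (x t))" for t
  define D where "D t = (f (x t) - f (y t)) + I t" for t
  have I_le: "infnorm (I t) \<le> K'" if "t \<in> {a..b}" for t
    unfolding I_def K'_def using v Kg B that by (intro infnorm_input_sum_le) auto
  have ac: "abs_continuous_on a b (\<lambda>t. x t - y t)"
    using x y by (auto simp: affine_solution_def intro: abs_continuous_on_diff)
  have "AE t in lebesgue_on {a..b}.
      (x has_vector_derivative f (x t) + (\<Sum>i=1..m. v i t *\<^sub>R g i (x t))) (at t within {a..b})"
    "AE t in lebesgue_on {a..b}.
      (y has_vector_derivative f (y t) + (\<Sum>i=1..m. w i t *\<^sub>R g i (y t))) (at t within {a..b})"
    using x y by (auto simp: affine_solution_def)
  then have der: "AE t in lebesgue_on {a..b}. t \<in> {a..b} \<and>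
      ((\<lambda>t. x t - y t) has_vector_derivative D t) (at t within {a..b})"
    using AE_space
  proof eventually_elim
    case (elim t)
    then have t: "t \<in> {a..b}" by simp
    then have "(\<Sum>i=1..m. w i t *\<^sub>R g i (y t)) = 0" using w by simp
    then show ?case
      using t has_vector_derivative_diff[OF elim(1,2)] by (simp add: D_def I_def algebra_simps)
  qed
  have split: "infnorm ((x t - y t) + h *\<^sub>R D t) \<le> infnorm ((x t - y t) + h *\<^sub>R (f (x t) - f (y t))) + h * K'"
    if "t \<in> {a..b}" "h > 0" for t h
  proof -
    have "(x t - y t) + h *\<^sub>R D t = ((x t - y t) + h *\<^sub>R (f (x t) - f (y t))) + h *\<^sub>R I t"
      by (simp add: D_def algebra_simps)
    then have "infnorm ((x t - y t) + h *\<^sub>R D t) \<le>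
        infnorm ((x t - y t) + h *\<^sub>R (f (x t) - f (y t))) + infnorm (h *\<^sub>R I t)"
      by (metis infnorm_triangle)
    also have "infnorm (h *\<^sub>R I t) \<le> h * K'"
      unfolding infnorm_mul using I_le[OF that(1)] that(2) by simp
    finally show ?thesis by simp
  qed
  have "infnorm (x b - y b) \<le>
      exp (\<Lambda> * (b - a)) * infnorm (x a - y a) + (b - a) * K' * phi (\<Lambda> * (b - a))"
  proof (rule infnorm_gronwall[OF \<open>a \<le> b\<close> ac], use der in eventually_elim)
    case (elim t)
    then have t: "t \<in> {a..b}" and seg: "closed_segment (y t) (x t) \<subseteq> B"
      using B \<open>convex B\<close> by (auto simp: convex_contains_segment)
    have "\<forall>\<^sub>F h in at_right 0.
        infnorm ((x t - y t) + h *\<^sub>R (f (x t) - f (y t))) \<le> (1 + h * \<Lambda>) * infnorm (x t - y t)"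
      using seg diff \<Lambda> by (intro infnorm_euler_step_le) auto
    then have "\<forall>\<^sub>F h in at_right 0. infnorm ((x t - y t) + h *\<^sub>R D t) \<le>
        infnorm (x t - y t) + h * (\<Lambda> * infnorm (x t - y t) + K')"
      using eventually_at_right_less[of 0]
    proof eventually_elim
      case (elim h)
      then show ?case using split[OF t, of h] by (simp add: algebra_simps)
    qed
    then show ?case using elim by blast
  qed
  then show "infnorm (x b - y b) \<le> (b - a) * K' * phi (\<Lambda> * (b - a))"
    using \<open>x a = y a\<close> by (simp add: infnorm_0)
  have "infnorm (x b - y b) \<le>
      exp (0 * (b - a)) * infnorm (x a - y a) + (b - a) * (2 * K + K') * phi (0 * (b - a))"
  proof (rule infnorm_gronwall[OF \<open>a \<le> b\<close> ac], use der in eventually_elim)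
    case (elim t)
    then have t: "t \<in> {a..b}" by simp
    have "\<forall>\<^sub>F h in at_right 0. infnorm ((x t - y t) + h *\<^sub>R D t) \<le>
        infnorm (x t - y t) + h * (0 * infnorm (x t - y t) + (2 * K + K'))"
      using eventually_at_right_less[of 0]
    proof eventually_elim
      case (elim h)
      have "infnorm (f (x t) - f (y t)) \<le> infnorm (f (x t)) + infnorm (f (y t))"
        using infnorm_triangle[of "f (x t)" "- f (y t)"] by (simp add: infnorm_neg)
      also have "\<dots> \<le> 2 * K" using K B t by (smt (verit))
      finally have "h * infnorm (f (x t) - f (y t)) \<le> h * (2 * K)"
        using elim by simp
      then have "infnorm (h *\<^sub>R (f (x t) - f (y t))) \<le> h * (2 * K)"
        unfolding infnorm_mul using elim by simp
      then have "infnorm ((x t - y t) + h *\<^sub>R D t) \<le> infnorm (x t - y t) + h * (2 * K) + h * K'"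
        using split[OF t elim] infnorm_triangle[of "x t - y t" "h *\<^sub>R (f (x t) - f (y t))"]
        by linarith
      then show ?case by (simp only: distrib_left mult_zero_left add_0 add.assoc)
    qed
    then show ?case using elim by blast
  qed
  then show "infnorm (x b - y b) \<le> (b - a) * (2 * K + K')"
    using \<open>x a = y a\<close> by (simp add: infnorm_0 phi_def)
qed

theorem theorem5:
  fixes T K \<Lambda> :: real and m :: nat and V Kg :: "nat \<Rightarrow> real"
  assumes "\<forall>i\<in>{1..m}. 0 < V i"
  shows "\<exists>C::real. \<forall>(f :: real ^ 'n \<Rightarrow> real ^ 'n) (g :: nat \<Rightarrow> real ^ 'n \<Rightarrow> real ^ 'n)
            (B :: (real ^ 'n) set) (N :: nat) (\<tau> :: nat \<Rightarrow> real) (k :: nat)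
            (v :: nat \<Rightarrow> real \<Rightarrow> real) (w :: nat \<Rightarrow> real \<Rightarrow> real)
            (x :: real \<Rightarrow> real ^ 'n) (y :: real \<Rightarrow> real ^ 'n).
      (\<exists>L. L-lipschitz_on UNIV f) \<and>
      (\<forall>z. f differentiable (at z)) \<and> continuous_on UNIV (\<lambda>z. jacobian f (at z)) \<and>
      (\<forall>i\<in>{1..m}. continuous_on UNIV (g i)) \<and>
      is_interval B \<and>
      (\<forall>z\<in>B. infnorm (f z) \<le> K) \<and>
      (\<forall>z\<in>B. \<forall>i\<in>{1..m}. infnorm (g i z) \<le> Kg i) \<and>
      (\<forall>z\<in>B. log_norm (jacobian f (at z)) \<le> \<Lambda>) \<and>
      \<tau> 0 = 0 \<and> \<tau> N = T \<and> (\<forall>j<N. \<tau> j < \<tau> (Suc j)) \<and> k < N \<and>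
      admissible_input m V (\<tau> k) (\<tau> (Suc k)) v \<and>
      (\<forall>i\<in>{1..m}. \<forall>t\<in>{\<tau> k..\<tau> (Suc k)}. w i t = 0) \<and>
      affine_solution f m g v (\<tau> k) (\<tau> (Suc k)) x \<and>
      affine_solution f m g w (\<tau> k) (\<tau> (Suc k)) y \<and>
      x (\<tau> k) = y (\<tau> k) \<and>
      (\<forall>t\<in>{\<tau> k..\<tau> (Suc k)}. x t \<in> B \<and> y t \<in> B)
      \<longrightarrow>
      (let h = \<tau> (Suc k) - \<tau> k;
           K' = (\<Sum>i=1..m. V i * Kg i);
           err = infnorm (x (\<tau> (Suc k)) - y (\<tau> (Suc k)))
       in err \<le> C * h \<and>
          err \<le> h * K' * phi (\<Lambda> * h) \<and>
          err \<le> h * (2 * K + K'))"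
proof (intro exI[of _ "2 * K + (\<Sum>i=1..m. V i * Kg i)"] allI impI, elim conjE, goal_cases)
  case (1 f g B N \<tau> k v w x y)
  then have "\<tau> k \<le> \<tau> (Suc k)" "convex B"
    by (auto intro: less_imp_le is_interval_convex)
  note drift_local_error[OF this(1) _ this(2), of f K m g Kg \<Lambda> v V w x y]
  with 1 show ?case
    by (auto simp: admissible_input_def Let_def mult.commute)
qed

end
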